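(* Let $\alpha\in(0,\pi)$ and let $\mathcal T_h=\hat T_L\cup\hat T_R\subset\mathbb R^2$ consist of two line segments meeting at $P=(0,0)$ whose unit normals $\nu_L,\nu_R$ enclose the angle $\alpha=\sphericalangle(\nu_L,\nu_R):=\arccos(\nu_L\cdot\nu_R)$. Let $\Psi:\mathbb R^2\to\mathbb R$ be continuous. For small $\varepsilon>0$ let $\mathcal T_\varepsilon$ be the $C^1$ curve obtained by replacing the part of $\mathcal T_h$ within distance $\varepsilon$ of $P$ by the circular arc meeting the two segments tangentially at the two points at distance $\varepsilon$ from $P$, let $\nu_\varepsilon$ be its unit normal, and let $\Psi_\varepsilon:=(\Psi\circ\Phi_\varepsilon^{-1})\,\mu_\varepsilon\otimes\mu_\varepsilon$ be the transported test function. Then $$\lim_{\varepsilon\to0}\int_{\mathcal T_\varepsilon}-\,\partial^{\mathcal S}\nu_\varepsilon:\Psi_\varepsilon\,ds=-\sphericalangle(\nu_L,\nu_R)\,\Psi(P).$$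
   Context: Coordinates: $\hat T_R=\{(s,0):0\le s\le \ell_R\}$ and $\hat T_L=\{-s(\cos\alpha,\sin\alpha):0\le s\le\ell_L\}$ with $\ell_L,\ell_R>0$, $\nu_R=(0,1)$, $\nu_L=(-\sin\alpha,\cos\alpha)$, and $0<\varepsilon<\min(\ell_L,\ell_R)$. Put $r_\varepsilon:=\varepsilon\frac{1+\cos\alpha}{\sin\alpha}$, $M_\varepsilon:=(\varepsilon,-r_\varepsilon)$ and $T_\varepsilon:=\{M_\varepsilon+r_\varepsilon(\cos s,\sin s):s\in(\frac\pi2,\frac\pi2+\alpha)\}$. Let $T_L,T_R$ be the parts of $\hat T_L,\hat T_R$ at distance at least $\varepsilon$ from $P$, and $\mathcal T_\varepsilon:=T_L\cup T_\varepsilon\cup T_R$. The normal field is $\nu_\varepsilon=\nu_L$ on $T_L$, $\nu_\varepsilon=\nu_R$ on $T_R$, and $\nu_\varepsilon(x)=\frac{x-M_\varepsilon}{\|x-M_\varepsilon\|}$ on $T_\varepsilon$. The tangential Jacobian is $\partial^{\mathcal S}\nu_\varepsilon=\partial\tilde\nu_\varepsilon(I-\nu_\varepsilon\otimes\nu_\varepsilon)$ for any local differentiable extension $\tilde\nu_\varepsilon$; it is taken piecewise on $T_L,T_\varepsilon,T_R$ (in particular, it is zero on $T_L$ and $T_R$). On $T_\varepsilon$, $\mu_\varepsilon(x):=\frac1{r_\varepsilon}(-(x_2-M_{\varepsilon,2}),\,x_1-M_{\varepsilon,1})$, and on $T_L,T_R$, $\mu_\varepsilon$ is a unit tangent vector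 of the segment. The bijection $\Phi_\varepsilon:\mathcal T_h\to\mathcal T_\varepsilon$ is the identity outside the open $\varepsilon$-ball around $P$, and inside it is $\Phi_\varepsilon(x)=M_\varepsilon+\frac{r_\varepsilon}{\|x-M_\varepsilon\|}(x-M_\varepsilon)$. $A:B$ is the Frobenius inner product and $(a\otimes b)c=(b\cdot c)a$. *)

theory Defs
  imports "HOL-Analysis.Analysis"
begin

section \<open>Integration over a curve with respect to arc length\<close>

text \<open>
  The curve is a set \<open>C\<close>. It is parametrised by an injective, continuous, piecewise
  continuously differentiable path \<open>g\<close> on the unit interval, and \<open>ds\<close> is
  \<open>\<parallel>g'(t)\<parallel> dt\<close>. The value is required to be the same for all such parametrisations, so
  that it depends on \<open>C\<close> only.
\<close>

definition curve_parametrisation :: "(real \<Rightarrow> 'a::real_normed_vector) \<Rightarrow> 'a set \<Rightarrow> bool" where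
  "curve_parametrisation g C \<longleftrightarrow> arc g \<and> valid_path g \<and> path_image g = C"

definition has_curve_integral ::
    "('a::real_normed_vector \<Rightarrow> real) \<Rightarrow> real \<Rightarrow> 'a set \<Rightarrow> bool" where
  "has_curve_integral f I C \<longleftrightarrow>
     (\<exists>g. curve_parametrisation g C) \<and>
     (\<forall>g. curve_parametrisation g C \<longrightarrow>
        ((\<lambda>t. f (g t) * norm (vector_derivative g (at t))) has_integral I) {0..1})"

definition curve_integral :: "'a set \<Rightarrow> ('a::real_normed_vector \<Rightarrow> real) \<Rightarrow> real" where
  "curve_integral C f = (THE I. has_curve_integral f I C)"

section \<open>Tensors and tangential derivatives\<close>

definition outer_prod :: "real^'n \<Rightarrow> real^'n \<Rightarrow> real^'n^'n" where
  "outer_prod a b = (\<chi> i j. a $ i * b $ j)"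

lemma outer_prod_mult_vec: "outer_prod a b *v c = (b \<bullet> c) *\<^sub>R a"
  by (simp add: outer_prod_def matrix_vector_mult_def vec_eq_iff inner_vec_def
      sum_distrib_left mult_ac)

definition frobenius_inner :: "real^'n^'m \<Rightarrow> real^'n^'m \<Rightarrow> real" where
  "frobenius_inner A B = (\<Sum>i\<in>UNIV. \<Sum>j\<in>UNIV. A $ i $ j * B $ i $ j)"

text \<open>
  \<open>tangential_jacobian S \<nu> x\<close> is meant for a curve \<open>S\<close> and its unit normal field \<open>\<nu>\<close>, of
  which only the values on \<open>S\<close> near \<open>x\<close> enter. The projection \<open>I - \<nu> \<otimes> \<nu>\<close> makes the
  result independent of the local extension \<open>\<nu>'\<close>, hence the definite description.
\<close>

definition tangential_jacobian ::
    "(real^'n) set \<Rightarrow> (real^'n \<Rightarrow> real^'n) \<Rightarrow> real^'n \<Rightarrow> real^'n^'n" where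
  "tangential_jacobian S \<nu> x =
     (THE J. \<exists>\<nu>' U. open U \<and> x \<in> U \<and> \<nu>' differentiable_on U \<and> (\<forall>y\<in>S \<inter> U. \<nu>' y = \<nu> y) \<and>
        J = jacobian \<nu>' (at x) ** (mat 1 - outer_prod (\<nu> x) (\<nu> x)))"

section \<open>The polygonal curve and its smoothing\<close>

definition normal_R :: "real^2" where
  "normal_R = vector [0, 1]"

definition normal_L :: "real \<Rightarrow> real^2" where
  "normal_L \<alpha> = vector [- sin \<alpha>, cos \<alpha>]"

definition direction_R :: "real^2" where
  "direction_R = vector [1, 0]"

definition direction_L :: "real \<Rightarrow> real^2" where
  "direction_L \<alpha> = vector [cos \<alpha>, sin \<alpha>]"

definition normal_angle :: "real^2 \<Rightarrow> real^2 \<Rightarrow> real" where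
  "normal_angle n m = arccos (n \<bullet> m)"

definition segment_R :: "real \<Rightarrow> (real^2) set" where
  "segment_R lR = {s *\<^sub>R direction_R | s. 0 \<le> s \<and> s \<le> lR}"

definition segment_L :: "real \<Rightarrow> real \<Rightarrow> (real^2) set" where
  "segment_L \<alpha> lL = {- (s *\<^sub>R direction_L \<alpha>) | s. 0 \<le> s \<and> s \<le> lL}"

definition curve_h :: "real \<Rightarrow> real \<Rightarrow> real \<Rightarrow> (real^2) set" where
  "curve_h \<alpha> lL lR = segment_L \<alpha> lL \<union> segment_R lR"

definition arc_radius :: "real \<Rightarrow> real \<Rightarrow> real" where
  "arc_radius \<alpha> \<epsilon> = \<epsilon> * ((1 + cos \<alpha>) / sin \<alpha>)"

definition arc_centre :: "real \<Rightarrow> real \<Rightarrow> real^2" where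
  "arc_centre \<alpha> \<epsilon> = vector [\<epsilon>, - arc_radius \<alpha> \<epsilon>]"

definition piece_arc :: "real \<Rightarrow> real \<Rightarrow> (real^2) set" where
  "piece_arc \<alpha> \<epsilon> =
     {arc_centre \<alpha> \<epsilon> + arc_radius \<alpha> \<epsilon> *\<^sub>R vector [cos s, sin s] | s. pi/2 < s \<and> s < pi/2 + \<alpha>}"

definition piece_L :: "real \<Rightarrow> real \<Rightarrow> real \<Rightarrow> (real^2) set" where
  "piece_L \<alpha> lL \<epsilon> = {x \<in> segment_L \<alpha> lL. \<epsilon> \<le> dist x 0}"

definition piece_R :: "real \<Rightarrow> real \<Rightarrow> (real^2) set" where
  "piece_R lR \<epsilon> = {x \<in> segment_R lR. \<epsilon> \<le> dist x 0}"

definition curve_eps :: "real \<Rightarrow> real \<Rightarrow> real \<Rightarrow> real \<Rightarrow> (real^2) set" where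
  "curve_eps \<alpha> lL lR \<epsilon> = piece_L \<alpha> lL \<epsilon> \<union> piece_arc \<alpha> \<epsilon> \<union> piece_R lR \<epsilon>"

definition normal_eps :: "real \<Rightarrow> real \<Rightarrow> real \<Rightarrow> real \<Rightarrow> real^2 \<Rightarrow> real^2" where
  "normal_eps \<alpha> lL lR \<epsilon> x =
     (if x \<in> piece_L \<alpha> lL \<epsilon> then normal_L \<alpha>
      else if x \<in> piece_R lR \<epsilon> then normal_R
      else (1 / norm (x - arc_centre \<alpha> \<epsilon>)) *\<^sub>R (x - arc_centre \<alpha> \<epsilon>))"

definition jacobian_normal_eps :: "real \<Rightarrow> real \<Rightarrow> real \<Rightarrow> real \<Rightarrow> real^2 \<Rightarrow> real^2^2" where
  "jacobian_normal_eps \<alpha> lL lR \<epsilon> x =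
     tangential_jacobian
       (if x \<in> piece_L \<alpha> lL \<epsilon> then piece_L \<alpha> lL \<epsilon>
        else if x \<in> piece_R lR \<epsilon> then piece_R lR \<epsilon>
        else piece_arc \<alpha> \<epsilon>)
       (normal_eps \<alpha> lL lR \<epsilon>) x"

text \<open>
  On the straight pieces the sign of the unit tangent is left open; only \<open>\<mu> \<otimes> \<mu>\<close> is used.
\<close>

definition tangent_field ::
    "real \<Rightarrow> real \<Rightarrow> real \<Rightarrow> real \<Rightarrow> (real^2 \<Rightarrow> real^2) \<Rightarrow> bool" where
  "tangent_field \<alpha> lL lR \<epsilon> \<mu> \<longleftrightarrow>
     (\<forall>x\<in>piece_arc \<alpha> \<epsilon>. \<mu> x = (1 / arc_radius \<alpha> \<epsilon>) *\<^sub>R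
        vector [- (x $ 2 - arc_centre \<alpha> \<epsilon> $ 2), x $ 1 - arc_centre \<alpha> \<epsilon> $ 1]) \<and>
     (\<forall>x\<in>piece_L \<alpha> lL \<epsilon>. norm (\<mu> x) = 1 \<and> \<mu> x \<in> span {direction_L \<alpha>}) \<and>
     (\<forall>x\<in>piece_R lR \<epsilon>. norm (\<mu> x) = 1 \<and> \<mu> x \<in> span {direction_R})"

text \<open>The map \<open>\<Phi>\<^sub>\<epsilon>\<close> is used on \<open>curve_h\<close> only, and is inverted there.\<close>

definition transport_map :: "real \<Rightarrow> real \<Rightarrow> real^2 \<Rightarrow> real^2" where
  "transport_map \<alpha> \<epsilon> x =
     (if x \<in> ball 0 \<epsilon>
      then arc_centre \<alpha> \<epsilon> +
           (arc_radius \<alpha> \<epsilon> / norm (x - arc_centre \<alpha> \<epsilon>)) *\<^sub>R (x - arc_centre \<alpha> \<epsilon>)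
      else x)"

definition transported_test ::
    "real \<Rightarrow> real \<Rightarrow> real \<Rightarrow> real \<Rightarrow> (real^2 \<Rightarrow> real^2) \<Rightarrow> (real^2 \<Rightarrow> real) \<Rightarrow> real^2 \<Rightarrow> real^2^2" where
  "transported_test \<alpha> lL lR \<epsilon> \<mu> \<Psi> x =
     \<Psi> (inv_into (curve_h \<alpha> lL lR) (transport_map \<alpha> \<epsilon>) x) *\<^sub>R outer_prod (\<mu> x) (\<mu> x)"

end

(*
  Parametrise the smoothed curve by the angle of its tangent on the arc and by arc length on the
  segments. The normal is constant on the segments, so they contribute nothing. On the arc the
  tangential Jacobian is (1/r) mu (x) mu, and the factor 1/r cancels against the arc length
  element r d theta: the integral equals - int_0^alpha Psi(z(theta)) d theta, where z(theta) is
  the point of the polygonal curve seen from the centre in direction theta. These points lie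
  within epsilon of the corner, so continuity of Psi gives the limit.

  The curve integral quantifies over all parametrisations. Any of them factors through the given
  regular one by a continuous injective, hence strictly monotone, change of parameter, which is
  differentiable off a finite set; the fundamental theorem of calculus then applies to a primitive
  composed with it.
*)
theory Submission
  imports Defs
begin

section \<open>Independence of the parametrisation\<close>

text \<open>Differentiability of \<open>\<sigma>\<close> is part of the conclusion. The scalar
  function \<open>\<gamma> z \<bullet> v\<close> of \<open>z\<close> has the nonzero derivative
  \<open>v \<bullet> v\<close> at \<open>\<sigma> t\<close>, so the difference quotient of
  \<open>\<sigma>\<close> is that of \<open>g y \<bullet> v\<close> divided by a factor with nonzero
  limit.\<close>

lemma lift_has_real_derivative:
  fixes \<gamma> g :: "real \<Rightarrow> 'a::real_inner" and \<sigma> :: "real \<Rightarrow> real"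
  assumes \<gamma>: "(\<gamma> has_vector_derivative v) (at (\<sigma> t))" and v: "v \<noteq> 0"
    and cont: "isCont \<sigma> t"
    and g: "(g has_vector_derivative w) (at t)"
    and lift: "\<forall>\<^sub>F y in nhds t. \<gamma> (\<sigma> y) = g y"
  obtains c where "(\<sigma> has_real_derivative c) (at t)" and "w = c *\<^sub>R v"
proof -
  have "((\<lambda>z. \<gamma> z \<bullet> v) has_vector_derivative v \<bullet> v) (at (\<sigma> t))"
    using bounded_linear.has_vector_derivative[OF bounded_linear_inner_left \<gamma>] .
  then have "((\<lambda>z. \<gamma> z \<bullet> v) has_real_derivative v \<bullet> v) (at (\<sigma> t))"
    by (simp add: has_real_derivative_iff_has_vector_derivative)
  \<comment> \<open>Caratheodory's slope function \<open>q\<close> involves no division by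
    \<open>z - \<sigma> t\<close>, so it may be evaluated at \<open>\<sigma> y\<close> even where
    \<open>\<sigma> y = \<sigma> t\<close>.\<close>
  then obtain q where q: "\<And>z. \<gamma> z \<bullet> v - \<gamma> (\<sigma> t) \<bullet> v = q z * (z - \<sigma> t)"
    and qc: "isCont q (\<sigma> t)" and qt: "q (\<sigma> t) = v \<bullet> v"
    unfolding CARAT_DERIV by blast
  have "((\<lambda>z. g z \<bullet> v) has_vector_derivative w \<bullet> v) (at t)"
    using bounded_linear.has_vector_derivative[OF bounded_linear_inner_left g] .
  then have "((\<lambda>z. g z \<bullet> v) has_real_derivative w \<bullet> v) (at t)"
    by (simp add: has_real_derivative_iff_has_vector_derivative)
  then have lim_g: "((\<lambda>y. (g y \<bullet> v - g t \<bullet> v) / (y - t)) \<longlongrightarrow> w \<bullet> v) (at t)"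
    by (simp add: has_field_derivative_iff)
  have "isCont (\<lambda>y. q (\<sigma> y)) t"
    using continuous_at_compose[OF cont, of q] qc by (simp add: o_def)
  then have lim_q: "((\<lambda>y. q (\<sigma> y)) \<longlongrightarrow> v \<bullet> v) (at t)"
    by (simp add: isCont_def qt)
  have "\<forall>\<^sub>F y in at t. q (\<sigma> y) \<noteq> 0"
    using tendsto_imp_eventually_ne[OF lim_q] v by simp
  moreover have "\<forall>\<^sub>F y in at t. \<gamma> (\<sigma> y) = g y"
    using lift by (simp add: eventually_at_filter eventually_mono)
  ultimately have
    "\<forall>\<^sub>F y in at t. (g y \<bullet> v - g t \<bullet> v) / (y - t) / q (\<sigma> y) = (\<sigma> y - \<sigma> t) / (y - t)"
  proof eventually_elim
    case (elim y)
    have "g y \<bullet> v - g t \<bullet> v = q (\<sigma> y) * (\<sigma> y - \<sigma> t)"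
      using q[of "\<sigma> y"] elim eventually_nhds_x_imp_x[OF lift] by simp
    then show ?case using elim by simp
  qed
  moreover have
    "((\<lambda>y. (g y \<bullet> v - g t \<bullet> v) / (y - t) / q (\<sigma> y)) \<longlongrightarrow> (w \<bullet> v) / (v \<bullet> v)) (at t)"
    using lim_g lim_q v by (intro tendsto_divide) auto
  ultimately have "((\<lambda>y. (\<sigma> y - \<sigma> t) / (y - t)) \<longlongrightarrow> (w \<bullet> v) / (v \<bullet> v)) (at t)"
    by (rule Lim_transform_eventually[rotated])
  then have \<sigma>: "(\<sigma> has_real_derivative (w \<bullet> v) / (v \<bullet> v)) (at t)"
    by (simp add: has_field_derivative_iff)
  \<comment> \<open>Since \<open>\<gamma> \<circ> \<sigma>\<close> agrees with \<open>g\<close> near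
    \<open>t\<close>, the chain rule and uniqueness of derivatives force \<open>w\<close> to be a
    multiple of \<open>v\<close>.\<close>
  have "((\<gamma> \<circ> \<sigma>) has_vector_derivative ((w \<bullet> v) / (v \<bullet> v)) *\<^sub>R v) (at t)"
    by (rule vector_diff_chain_at[where f = \<sigma> and x = t, OF _ \<gamma>])
      (use \<sigma> in \<open>simp add: has_real_derivative_iff_has_vector_derivative\<close>)
  moreover have "((\<gamma> \<circ> \<sigma>) has_vector_derivative w) (at t)"
    using g lift by (subst has_vector_derivative_cong_ev[where g = g])
      (auto simp: eventually_mono dest: eventually_nhds_x_imp_x)
  ultimately have "w = ((w \<bullet> v) / (v \<bullet> v)) *\<^sub>R v"
    using vector_derivative_unique_at by blast
  with \<sigma> show thesis ..
qed

lemma has_curve_integral_unique: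
  assumes "has_curve_integral f I C" and "has_curve_integral f J C"
  shows "I = J"
  using assms unfolding has_curve_integral_def by (meson has_integral_unique)

lemma curve_integral_eqI: "has_curve_integral f I C \<Longrightarrow> curve_integral C f = I"
  unfolding curve_integral_def using has_curve_integral_unique by blast

lemma strict_mono_on_deriv_nonneg:
  fixes f :: "real \<Rightarrow> real"
  assumes "strict_mono_on S f" and "t \<in> interior S" and "(f has_real_derivative c) (at t)"
  shows "0 \<le> c"
proof -
  have "mono_on S f" using assms(1) by (simp add: strict_mono_on_imp_mono_on)
  then show ?thesis
    using assms mono_on_imp_deriv_nonneg by blast
qed

text \<open>With \<open>\<sigma>\<close> the change of parameter from \<open>g\<close> to
  \<open>\<gamma>\<close>, \<open>F \<circ> \<sigma>\<close> is a primitive of the integrand up to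
  the sign of the derivative of \<open>\<sigma>\<close>. When \<open>\<sigma>\<close> decreases,
  that sign and the order of the end points both flip, so the value stays the same.\<close>

lemma has_integral_along_parametrisation:
  fixes \<gamma> g :: "real \<Rightarrow> 'a::real_inner"
  assumes "A < B" and cont\<gamma>: "continuous_on {A..B} \<gamma>" and inj\<gamma>: "inj_on \<gamma> {A..B}"
    and "finite K"
    and \<gamma>': "\<And>s. s \<in> {A<..<B} - K \<Longrightarrow> (\<gamma> has_vector_derivative \<gamma>' s) (at s)"
    and \<gamma>'0: "\<And>s. s \<in> {A<..<B} - K \<Longrightarrow> \<gamma>' s \<noteq> 0"
    and contF: "continuous_on {A..B} F"
    and F': "\<And>s. s \<in> {A<..<B} - K \<Longrightarrow>
               (F has_real_derivative f (\<gamma> s) * norm (\<gamma>' s)) (at s)"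
    and g: "curve_parametrisation g (\<gamma> ` {A..B})"
  shows "((\<lambda>t. f (g t) * norm (vector_derivative g (at t))) has_integral F B - F A) {0..1}"
proof -
  have contg: "continuous_on {0..1} g" and injg: "inj_on g {0..1}"
    and imgg: "g ` {0..1} = \<gamma> ` {A..B}" and valg: "valid_path g"
    using g by (auto simp: curve_parametrisation_def arc_def path_def path_image_def)
  obtain S where "finite S" and S: "\<And>t. t \<in> {0..1} - S \<Longrightarrow> g differentiable (at t)"
    using valg piecewise_C1_differentiable_on_def C1_differentiable_on_eq
    unfolding valid_path_def by metis
  define \<sigma> where "\<sigma> = the_inv_into {A..B} \<gamma> \<circ> g"
  have \<gamma>\<sigma>: "\<gamma> (\<sigma> t) = g t" if "t \<in> {0..1}" for t
    unfolding \<sigma>_def using that imgg by (auto intro!: f_the_inv_into_f[OF inj\<gamma>])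
  have img\<sigma>: "\<sigma> ` {0..1} = {A..B}"
    unfolding \<sigma>_def image_comp[symmetric] imgg by (rule the_inv_into_onto[OF inj\<gamma>])
  have cont\<sigma>: "continuous_on {0..1} \<sigma>"
    unfolding \<sigma>_def
    by (intro continuous_on_compose contg) (simp add: imgg continuous_on_inv_into cont\<gamma> inj\<gamma>)
  have inj\<sigma>: "inj_on \<sigma> {0..1}"
    using injg \<gamma>\<sigma> by (metis inj_on_def)
  have end_points: "\<sigma> 0 \<in> {A..B}" "\<sigma> 1 \<in> {A..B}"
    unfolding img\<sigma>[symmetric] by simp_all
  \<comment> \<open>The parameters at which \<open>g\<close> may fail to be differentiable, together
    with those sent to the exceptional set of \<open>\<gamma>\<close>. The latter are finitely many
    because \<open>\<sigma>\<close> is injective.\<close>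
  define E where "E = S \<union> {t \<in> {0..1}. \<sigma> t \<in> K}"
  have "finite {t \<in> {0..1}. \<sigma> t \<in> K}"
    using finite_vimage_IntI[OF \<open>finite K\<close> inj\<sigma>] by (simp add: vimage_def Int_def conj_commute)
  then have finE: "finite E" using \<open>finite S\<close> by (simp add: E_def)
  have mono: "strict_mono_on {0..1} \<sigma> \<or> strict_antimono_on {0..1} \<sigma>"
    using inj\<sigma> injective_eq_monotone_map[of "{0..1}" \<sigma>] cont\<sigma> by (simp add: is_interval_cc)
  \<comment> \<open>The derivatives of \<open>\<gamma>\<close> and \<open>F\<close> are available
    only at interior parameters; strict monotonicity keeps \<open>\<sigma>\<close> away from the end
    points.\<close>
  have inner: "\<sigma> t \<in> {A<..<B}" if "t \<in> {0<..<1}" for t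
    using mono
  proof
    assume m: "strict_mono_on {0..1} \<sigma>"
    have "\<sigma> 0 < \<sigma> t" "\<sigma> t < \<sigma> 1" using that by (auto intro!: strict_mono_onD[OF m])
    then show ?thesis using end_points by auto
  next
    assume m: "strict_antimono_on {0..1} \<sigma>"
    have "\<sigma> 0 > \<sigma> t" "\<sigma> t > \<sigma> 1" using that by (auto intro!: monotone_onD[OF m])
    then show ?thesis using end_points by auto
  qed
  have der: "\<exists>c. (\<sigma> has_real_derivative c) (at t) \<and>
      vector_derivative g (at t) = c *\<^sub>R \<gamma>' (\<sigma> t) \<and>
      ((F \<circ> \<sigma>) has_real_derivative f (g t) * norm (\<gamma>' (\<sigma> t)) * c) (at t)"
    if t: "t \<in> {0<..<1} - E" for t
  proof -
    have st: "\<sigma> t \<in> {A<..<B} - K" using t inner[of t] by (auto simp: E_def)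
    have "isCont \<sigma> t"
      using cont\<sigma> t continuous_on_interior[of "{0..1}" \<sigma> t] by simp
    moreover have "(g has_vector_derivative vector_derivative g (at t)) (at t)"
      using S[of t] t by (simp add: E_def vector_derivative_works[symmetric])
    moreover have "\<forall>\<^sub>F y in nhds t. y \<in> {0<..<1}"
      using t by (intro eventually_nhds_in_open) auto
    then have "\<forall>\<^sub>F y in nhds t. \<gamma> (\<sigma> y) = g y"
      by eventually_elim (use \<gamma>\<sigma> in auto)
    ultimately obtain c where c: "(\<sigma> has_real_derivative c) (at t)"
      "vector_derivative g (at t) = c *\<^sub>R \<gamma>' (\<sigma> t)"
      using lift_has_real_derivative[where \<sigma> = \<sigma> and t = t, OF \<gamma>'[OF st] \<gamma>'0[OF st]] by blast
    then show ?thesis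
      using DERIV_chain[where g = \<sigma> and x = t, OF F'[OF st], of c] \<gamma>\<sigma>[of t] t by auto
  qed
  have contF\<sigma>: "continuous_on {0..1} (F \<circ> \<sigma>)"
    using cont\<sigma> contF img\<sigma> by (intro continuous_on_compose) auto
  show ?thesis
    using mono
  proof
    assume m: "strict_mono_on {0..1} \<sigma>"
    have "A \<in> \<sigma> ` {0..1}" "B \<in> \<sigma> ` {0..1}"
      using img\<sigma> \<open>A < B\<close> by auto
    moreover have "\<sigma> 0 \<le> \<sigma> t \<and> \<sigma> t \<le> \<sigma> 1" if "t \<in> {0..1}" for t
      using that by (auto intro!: mono_onD[OF strict_mono_on_imp_mono_on[OF m]])
    ultimately have ends: "\<sigma> 0 = A" "\<sigma> 1 = B"
      using end_points by force+
    have "((\<lambda>t. f (g t) * norm (vector_derivative g (at t)))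
        has_integral (F \<circ> \<sigma>) 1 - (F \<circ> \<sigma>) 0) {0..1}"
    proof (rule fundamental_theorem_of_calculus_interior_strong[OF finE _ _ contF\<sigma>])
      fix t :: real assume t: "t \<in> {0<..<1} - E"
      then obtain c where c: "(\<sigma> has_real_derivative c) (at t)"
        "vector_derivative g (at t) = c *\<^sub>R \<gamma>' (\<sigma> t)"
        "((F \<circ> \<sigma>) has_real_derivative f (g t) * norm (\<gamma>' (\<sigma> t)) * c) (at t)"
        using der by blast
      \<comment> \<open>This removes the absolute value in
        \<open>norm (c *\<^sub>R \<gamma>' (\<sigma> t))\<close>; the value \<open>c = 0\<close> is
        possible and harmless.\<close>
      have "0 \<le> c"
        using strict_mono_on_deriv_nonneg[OF m _ c(1)] t by simp
      then show "((F \<circ> \<sigma>) has_vector_derivative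
          f (g t) * norm (vector_derivative g (at t))) (at t)"
        using c by (simp add: has_real_derivative_iff_has_vector_derivative mult_ac)
    qed simp
    then show ?thesis by (simp add: ends)
  next
    assume m: "strict_antimono_on {0..1} \<sigma>"
    then have m': "strict_mono_on {0..1} (\<lambda>t. - \<sigma> t)"
      by (simp add: monotone_on_def)
    have "A \<in> \<sigma> ` {0..1}" "B \<in> \<sigma> ` {0..1}"
      using img\<sigma> \<open>A < B\<close> by auto
    moreover have "- \<sigma> 0 \<le> - \<sigma> t \<and> - \<sigma> t \<le> - \<sigma> 1" if "t \<in> {0..1}" for t
      using that by (auto intro!: mono_onD[OF strict_mono_on_imp_mono_on[OF m'], simplified])
    ultimately have ends: "\<sigma> 0 = B" "\<sigma> 1 = A"
      using end_points by force+
    \<comment> \<open>Orientation is reversed: \<open>F \<circ> \<sigma>\<close> is a primitive of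
      the negated integrand and runs from \<open>F B\<close> to \<open>F A\<close>.\<close>
    have "((\<lambda>t. - (f (g t) * norm (vector_derivative g (at t))))
        has_integral (F \<circ> \<sigma>) 1 - (F \<circ> \<sigma>) 0) {0..1}"
    proof (rule fundamental_theorem_of_calculus_interior_strong[OF finE _ _ contF\<sigma>])
      fix t :: real assume t: "t \<in> {0<..<1} - E"
      then obtain c where c: "(\<sigma> has_real_derivative c) (at t)"
        "vector_derivative g (at t) = c *\<^sub>R \<gamma>' (\<sigma> t)"
        "((F \<circ> \<sigma>) has_real_derivative f (g t) * norm (\<gamma>' (\<sigma> t)) * c) (at t)"
        using der by blast
      have "0 \<le> - c"
        using strict_mono_on_deriv_nonneg[OF m' _ DERIV_minus[OF c(1)]] t by simp
      then show "((F \<circ> \<sigma>) has_vector_derivative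
          - (f (g t) * norm (vector_derivative g (at t)))) (at t)"
        using c by (simp add: has_real_derivative_iff_has_vector_derivative mult_ac)
    qed simp
    from has_integral_neg[OF this] show ?thesis by (simp add: ends)
  qed
qed

text \<open>\<open>has_curve_integral\<close> also demands that some parametrisation exists;
  rescaling \<open>\<gamma>\<close> affinely to the unit interval supplies one. The preceding lemma
  gives the same value for all of them.\<close>

lemma has_curve_integral_parametrised:
  fixes \<gamma> :: "real \<Rightarrow> 'a::real_inner"
  assumes "A < B" and inj\<gamma>: "inj_on \<gamma> {A..B}"
    and pw: "\<gamma> piecewise_C1_differentiable_on {A..B}"
    and "finite K"
    and \<gamma>': "\<And>s. s \<in> {A<..<B} - K \<Longrightarrow> (\<gamma> has_vector_derivative \<gamma>' s) (at s)"
    and \<gamma>'0: "\<And>s. s \<in> {A<..<B} - K \<Longrightarrow> \<gamma>' s \<noteq> 0"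
    and contF: "continuous_on {A..B} F"
    and F': "\<And>s. s \<in> {A<..<B} - K \<Longrightarrow>
               (F has_real_derivative f (\<gamma> s) * norm (\<gamma>' s)) (at s)"
  shows "has_curve_integral f (F B - F A) (\<gamma> ` {A..B})"
proof -
  have cont\<gamma>: "continuous_on {A..B} \<gamma>"
    using pw by (simp add: piecewise_C1_differentiable_on_def)
  define p where "p = \<gamma> \<circ> (\<lambda>t. (B - A) *\<^sub>R t + A)"
  have img: "(\<lambda>t. (B - A) * t + A) ` {0..1} = {A..B}"
    using \<open>A < B\<close> by (simp add: image_affinity_atLeastAtMost)
  have valid: "valid_path p"
    unfolding valid_path_def p_def
    by (rule piecewise_C1_differentiable_affine) (simp add: img pw)
  have "inj_on p {0..1}"
    unfolding p_def
    by (rule comp_inj_on) (use \<open>A < B\<close> in \<open>auto simp: inj_on_def img intro: inj_onD[OF inj\<gamma>]\<close>)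
  moreover have "path_image p = \<gamma> ` {A..B}"
    unfolding path_image_def p_def image_comp[symmetric] by (simp add: img)
  ultimately have "curve_parametrisation p (\<gamma> ` {A..B})"
    using valid valid_path_imp_path[OF valid] by (simp add: curve_parametrisation_def arc_def)
  then show ?thesis
    unfolding has_curve_integral_def
    using has_integral_along_parametrisation[OF \<open>A < B\<close> cont\<gamma> inj\<gamma> \<open>finite K\<close> \<gamma>' \<gamma>'0 contF F']
    by blast
qed

section \<open>Tensors and tangential Jacobians\<close>

lemma matrix_mul_outer_prod: "A ** outer_prod a b = outer_prod (A *v a) b"
  by (simp add: outer_prod_def matrix_matrix_mult_def matrix_vector_mult_def vec_eq_iff
      sum_distrib_left mult_ac)

lemma outer_prod_scaleR_left: "outer_prod (c *\<^sub>R a) b = c *\<^sub>R outer_prod a b"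
  by (simp add: outer_prod_def vec_eq_iff)

lemma outer_prod_minus_minus: "outer_prod (- a) (- b) = outer_prod a b"
  by (simp add: outer_prod_def vec_eq_iff)

lemma frobenius_inner_outer_prod:
  "frobenius_inner (outer_prod a b) (outer_prod c d) = (a \<bullet> c) * (b \<bullet> d)"
proof -
  have "frobenius_inner (outer_prod a b) (outer_prod c d)
      = (\<Sum>i\<in>UNIV. \<Sum>j\<in>UNIV. (a $ i * c $ i) * (b $ j * d $ j))"
    by (simp add: frobenius_inner_def outer_prod_def mult_ac)
  then show ?thesis by (simp add: inner_vec_def sum_product)
qed

lemma frobenius_inner_scaleR_left: "frobenius_inner (c *\<^sub>R A) B = c * frobenius_inner A B"
  by (simp add: frobenius_inner_def sum_distrib_left mult_ac)

lemma frobenius_inner_scaleR_right: "frobenius_inner A (c *\<^sub>R B) = c * frobenius_inner A B"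
  by (simp add: frobenius_inner_def sum_distrib_left mult_ac)

text \<open>When the projection is \<open>\<mu> \<otimes> \<mu>\<close>, only the derivative of an
  extension in direction \<open>\<mu>\<close> survives. By the chain rule along \<open>c\<close> it
  is determined by the values of \<open>\<nu>\<close> on the curve, so all extensions give the same
  matrix. The factor \<open>k\<close> is the signed speed of \<open>c\<close>.\<close>

lemma tangential_jacobian_along_curve:
  fixes \<nu> :: "real^'n \<Rightarrow> real^'n" and c :: "real \<Rightarrow> real^'n"
  assumes c: "(c has_vector_derivative k *\<^sub>R \<mu>) (at s)" and "k \<noteq> 0"
    and on_S: "\<forall>\<^sub>F t in nhds s. c t \<in> S"
    and \<nu>c: "((\<lambda>t. \<nu> (c t)) has_vector_derivative k *\<^sub>R w) (at s)"
    and proj: "mat 1 - outer_prod (\<nu> (c s)) (\<nu> (c s)) = outer_prod \<mu> \<mu>"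
    and ext: "N differentiable_on UNIV" "\<And>y. y \<in> S \<Longrightarrow> N y = \<nu> y"
  shows "tangential_jacobian S \<nu> (c s) = outer_prod w \<mu>"
proof -
  have jac: "jacobian \<nu>' (at (c s)) ** (mat 1 - outer_prod (\<nu> (c s)) (\<nu> (c s))) = outer_prod w \<mu>"
    if U: "open U" "c s \<in> U" "\<nu>' differentiable_on U" and agree: "\<forall>y\<in>S \<inter> U. \<nu>' y = \<nu> y"
    for \<nu>' U
  proof -
    have "\<nu>' differentiable (at (c s))"
      using U by (metis at_within_open differentiable_on_def)
    then have "(\<nu>' has_derivative (*v) (jacobian \<nu>' (at (c s)))) (at (c s))"
      by (simp add: jacobian_works[symmetric])
    from vector_derivative_diff_chain_within[OF c has_derivative_at_withinI[OF this]]
    have chain: "((\<nu>' \<circ> c) has_vector_derivative jacobian \<nu>' (at (c s)) *v (k *\<^sub>R \<mu>)) (at s)" .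
    have "isCont c s"
      using c has_vector_derivative_continuous by blast
    then have "\<forall>\<^sub>F t in nhds s. c t \<in> U"
      using U by (simp add: continuous_at_open eventually_nhds)
    with on_S have ev: "\<forall>\<^sub>F t in nhds s. \<nu>' (c t) = \<nu> (c t)"
      by eventually_elim (use agree in auto)
    have "((\<nu>' \<circ> c) has_vector_derivative k *\<^sub>R w) (at s)"
      using \<nu>c ev by (subst has_vector_derivative_cong_ev[where g = "\<lambda>t. \<nu> (c t)"])
        (auto simp: eventually_mono dest: eventually_nhds_x_imp_x)
    with chain have "jacobian \<nu>' (at (c s)) *v (k *\<^sub>R \<mu>) = k *\<^sub>R w"
      using vector_derivative_unique_at by blast
    then have "jacobian \<nu>' (at (c s)) *v \<mu> = w"
      using \<open>k \<noteq> 0\<close> by (simp add: matrix_vector_mult_scaleR)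
    then show ?thesis
      by (simp add: proj matrix_mul_outer_prod)
  qed
  show ?thesis
    unfolding tangential_jacobian_def
  proof (rule the_equality)
    \<comment> \<open>The definite description also needs one extension to exist; \<open>N\<close>
      is a global one.\<close>
    show "\<exists>\<nu>' U. open U \<and> c s \<in> U \<and> \<nu>' differentiable_on U \<and> (\<forall>y\<in>S \<inter> U. \<nu>' y = \<nu> y) \<and>
        outer_prod w \<mu> = jacobian \<nu>' (at (c s)) ** (mat 1 - outer_prod (\<nu> (c s)) (\<nu> (c s)))"
      using jac[of UNIV N] ext by (intro exI[of _ N] exI[of _ UNIV]) auto
  qed (use jac in blast)
qed

section \<open>Rotating orthonormal frames in the plane\<close>

lemma vec2_eq_iff: "(x :: real^2) = y \<longleftrightarrow> x $ 1 = y $ 1 \<and> x $ 2 = y $ 2"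
  by (simp add: vec_eq_iff forall_2)

lemma inner_vec2: "(x :: real^2) \<bullet> y = x $ 1 * y $ 1 + x $ 2 * y $ 2"
  by (simp add: inner_vec_def sum_2)

lemma direction_L_nth [simp]: "direction_L \<theta> $ 1 = cos \<theta>" "direction_L \<theta> $ 2 = sin \<theta>"
  by (simp_all add: direction_L_def)

lemma normal_L_nth [simp]: "normal_L \<theta> $ 1 = - sin \<theta>" "normal_L \<theta> $ 2 = cos \<theta>"
  by (simp_all add: normal_L_def)

lemma direction_R_eq: "direction_R = direction_L 0"
  by (simp add: direction_R_def direction_L_def)

lemma normal_R_eq: "normal_R = normal_L 0"
  by (simp add: normal_R_def normal_L_def)

lemma inner_direction_L: "direction_L \<theta> \<bullet> direction_L \<phi> = cos (\<theta> - \<phi>)"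
  by (simp add: inner_vec2 cos_diff)

lemma inner_normal_L: "normal_L \<theta> \<bullet> normal_L \<phi> = cos (\<theta> - \<phi>)"
  by (simp add: inner_vec2 cos_diff)

lemma inner_normal_L_direction_L: "normal_L \<theta> \<bullet> direction_L \<phi> = sin (\<phi> - \<theta>)"
  by (simp add: inner_vec2 sin_diff)

lemma inner_direction_L_normal_L: "direction_L \<theta> \<bullet> normal_L \<phi> = sin (\<theta> - \<phi>)"
  by (simp add: inner_vec2 sin_diff)

lemma norm_direction_L [simp]: "norm (direction_L \<theta>) = 1"
  by (simp add: norm_eq_sqrt_inner inner_direction_L)

lemma norm_normal_L [simp]: "norm (normal_L \<theta>) = 1"
  by (simp add: norm_eq_sqrt_inner inner_normal_L)

lemma normal_L_neq_0 [simp]: "normal_L \<theta> \<noteq> 0"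
  by (metis norm_normal_L norm_zero zero_neq_one)

text \<open>This is the completeness relation of the orthonormal frame; it provides the projection
  hypothesis of \<open>tangential_jacobian_along_curve\<close>.\<close>

lemma projection_normal_L:
  "mat 1 - outer_prod (normal_L \<theta>) (normal_L \<theta>) = outer_prod (direction_L \<theta>) (direction_L \<theta>)"
  by (simp add: vec_eq_iff forall_2 outer_prod_def mat_def power2_eq_square[symmetric]
      sin_squared_eq)

lemma direction_L_axis: "direction_L \<theta> = cos \<theta> *\<^sub>R axis 1 1 + sin \<theta> *\<^sub>R axis 2 1"
  by (simp add: vec2_eq_iff axis_def)

lemma normal_L_axis: "normal_L \<theta> = (- sin \<theta>) *\<^sub>R axis 1 1 + cos \<theta> *\<^sub>R axis 2 1"
  by (simp add: vec2_eq_iff axis_def)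

lemma normal_L_has_vector_derivative:
  "(normal_L has_vector_derivative - direction_L \<theta>) (at \<theta>)"
  unfolding normal_L_axis[abs_def] direction_L_axis
  by (auto intro!: derivative_eq_intros)

lemma continuous_on_direction_L [continuous_intros]:
  fixes f :: "'a::t2_space \<Rightarrow> real"
  shows "continuous_on S f \<Longrightarrow> continuous_on S (\<lambda>x. direction_L (f x))"
  unfolding direction_L_axis
  by (intro continuous_intros)

lemma continuous_on_normal_L [continuous_intros]:
  fixes f :: "'a::t2_space \<Rightarrow> real"
  shows "continuous_on S f \<Longrightarrow> continuous_on S (\<lambda>x. normal_L (f x))"
  unfolding normal_L_axis
  by (intro continuous_intros)

section \<open>The smoothed corner\<close>

lemma orthonormal_expansion:
  "x = (x \<bullet> direction_L \<theta>) *\<^sub>R direction_L \<theta> + (x \<bullet> normal_L \<theta>) *\<^sub>R normal_L \<theta>"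
proof -
  have "a = (a * cos \<theta> + b * sin \<theta>) * cos \<theta> - (b * cos \<theta> - a * sin \<theta>) * sin \<theta>"
    and "b = (a * cos \<theta> + b * sin \<theta>) * sin \<theta> + (b * cos \<theta> - a * sin \<theta>) * cos \<theta>" for a b
    using sin_cos_squared_add[of \<theta>] by algebra+
  then show ?thesis by (simp add: vec2_eq_iff inner_vec2)
qed

section \<open>Parametrisation of the smoothed curve by its tangent angle\<close>

locale smoothed_corner =
  fixes \<alpha> lL lR \<epsilon> :: real
  assumes \<alpha>: "0 < \<alpha>" "\<alpha> < pi" and \<epsilon>: "0 < \<epsilon>" "\<epsilon> < lL" "\<epsilon> < lR"
begin

abbreviation "r \<equiv> arc_radius \<alpha> \<epsilon>"
abbreviation "M \<equiv> arc_centre \<alpha> \<epsilon>"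

text \<open>Clamping to the range from 0 to \<open>\<alpha>\<close> lets one formula describe both
  segments and the arc.\<close>

definition tangent_angle :: "real \<Rightarrow> real" where
  "tangent_angle s = max 0 (min \<alpha> s)"

text \<open>The difference \<open>s - tangent_angle s\<close> is the signed length travelled on a
  segment, measured from its contact point with the arc: negative on the right, positive on the
  left, zero on the arc. The curve runs from right to left, against \<open>direction_L\<close>,
  whence the minus signs.\<close>

definition param :: "real \<Rightarrow> real^2" where
  "param s = M + r *\<^sub>R normal_L (tangent_angle s) - (s - tangent_angle s) *\<^sub>R direction_L (tangent_angle s)"

text \<open>The speed jumps between 1 and \<open>r\<close> at the contact points, so
  \<open>param\<close> is in general only piecewise C1 although the curve is C1. The values at 0 and
  \<open>\<alpha>\<close> are mere conventions.\<close>

definition param_deriv :: "real \<Rightarrow> real^2" where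
  "param_deriv s = - ((if 0 < s \<and> s < \<alpha> then r else 1) *\<^sub>R direction_L (tangent_angle s))"

abbreviation "A \<equiv> \<epsilon> - lR"
abbreviation "B \<equiv> \<alpha> + (lL - \<epsilon>)"

lemma sin_\<alpha>_pos: "0 < sin \<alpha>"
  using \<alpha> by (rule sin_gt_zero)

lemma r_pos: "0 < r"
proof -
  have "cos pi < cos \<alpha>" using \<alpha> by (intro cos_monotone_0_pi) auto
  then show ?thesis using sin_\<alpha>_pos \<epsilon> by (simp add: arc_radius_def)
qed

lemma centre_R: "M = \<epsilon> *\<^sub>R direction_L 0 - r *\<^sub>R normal_L 0"
  by (simp add: arc_centre_def vec2_eq_iff)

text \<open>The centre is defined relative to the right segment. Tangency to the left one rests on
  \<open>r\<close> being \<open>\<epsilon>\<close> times the cotangent of \<open>\<alpha>/2\<close>,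
  which can be written as (1 + cos)/sin or as sin/(1 - cos).\<close>

lemma centre_L: "M = - (\<epsilon> *\<^sub>R direction_L \<alpha>) - r *\<^sub>R normal_L \<alpha>"
proof -
  have r_sin: "r * sin \<alpha> = \<epsilon> * (1 + cos \<alpha>)"
    using sin_\<alpha>_pos by (simp add: arc_radius_def)
  have "(r * (1 - cos \<alpha>)) * sin \<alpha> = (\<epsilon> * sin \<alpha>) * sin \<alpha>"
    using r_sin sin_cos_squared_add[of \<alpha>] by algebra
  then have "r * (1 - cos \<alpha>) = \<epsilon> * sin \<alpha>"
    using sin_\<alpha>_pos by simp
  with r_sin show ?thesis
    by (simp add: arc_centre_def vec2_eq_iff algebra_simps)
qed

lemma tangent_angle_simps [simp]:
  "s \<le> 0 \<Longrightarrow> tangent_angle s = 0" "0 \<le> s \<Longrightarrow> s \<le> \<alpha> \<Longrightarrow> tangent_angle s = s" "\<alpha> \<le> s \<Longrightarrow> tangent_angle s = \<alpha>"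
  using \<alpha> by (auto simp: tangent_angle_def)

lemma continuous_on_tangent_angle: "continuous_on S tangent_angle"
  unfolding tangent_angle_def by (intro continuous_intros)

lemma param_R: "s \<le> 0 \<Longrightarrow> param s = (\<epsilon> - s) *\<^sub>R direction_L 0"
  by (simp add: param_def centre_R algebra_simps)

lemma param_arc: "0 \<le> s \<Longrightarrow> s \<le> \<alpha> \<Longrightarrow> param s = M + r *\<^sub>R normal_L s"
  by (simp add: param_def)

lemma param_L: "\<alpha> \<le> s \<Longrightarrow> param s = - ((\<epsilon> + (s - \<alpha>)) *\<^sub>R direction_L \<alpha>)"
  by (simp add: param_def centre_L algebra_simps)

lemma continuous_on_param: "continuous_on S param"
  unfolding param_def by (intro continuous_intros continuous_on_tangent_angle)

text \<open>Every tangent encloses an angle of at most \<open>\<alpha>/2 < \<pi>/2\<close> with the bisecting direction,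
  so the curve is a graph over that direction.\<close>

lemma param_height_strict_antimono:
  assumes "s < t"
  shows "param t \<bullet> direction_L (\<alpha>/2) < param s \<bullet> direction_L (\<alpha>/2)"
proof -
  have height: "param s \<bullet> direction_L (\<alpha>/2) = M \<bullet> direction_L (\<alpha>/2)
      + r * sin (\<alpha>/2 - tangent_angle s) - (s - tangent_angle s) * cos (\<alpha>/2)" for s
  proof -
    \<comment> \<open>Off the arc the tangent angle is 0 or \<open>\<alpha>\<close>, both at
      distance \<open>\<alpha>/2\<close> from the bisector; on the arc the first factor
      vanishes.\<close>
    have "(s - tangent_angle s) * cos (tangent_angle s - \<alpha>/2) = (s - tangent_angle s) * cos (\<alpha>/2)"
      by (cases "s \<le> 0"; cases "s \<le> \<alpha>") (auto simp: algebra_simps)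
    then show ?thesis
      by (simp add: param_def inner_add_left inner_diff_left inner_direction_L
          inner_normal_L_direction_L)
  qed
  have cos_pos: "0 < cos (\<alpha>/2)"
    using \<alpha> by (intro cos_gt_zero) auto
  have range: "0 \<le> tangent_angle u" "tangent_angle u \<le> \<alpha>" for u
    using \<alpha> by (auto simp: tangent_angle_def)
  have le: "tangent_angle s \<le> tangent_angle t" "s - tangent_angle s \<le> t - tangent_angle t"
    using assms by (auto simp: tangent_angle_def)
  have sin_le: "sin (\<alpha>/2 - tangent_angle t) \<le> sin (\<alpha>/2 - tangent_angle s)"
    using range[of s] range[of t] le \<alpha> by (intro sin_monotone_2pi_le) auto
  \<comment> \<open>The angle and the length on the segments are both nondecreasing and add up to
    the parameter, so at least one of them grows strictly.\<close>
  consider "tangent_angle s < tangent_angle t" | "s - tangent_angle s < t - tangent_angle t"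
    using assms le by linarith
  then show ?thesis
  proof cases
    case 1
    then have "sin (\<alpha>/2 - tangent_angle t) < sin (\<alpha>/2 - tangent_angle s)"
      using range[of s] range[of t] \<alpha> by (intro sin_monotone_2pi) auto
    then have "r * sin (\<alpha>/2 - tangent_angle t) < r * sin (\<alpha>/2 - tangent_angle s)"
      using r_pos by simp
    moreover have "(s - tangent_angle s) * cos (\<alpha>/2) \<le> (t - tangent_angle t) * cos (\<alpha>/2)"
      using le cos_pos by (intro mult_right_mono) auto
    ultimately show ?thesis by (simp add: height)
  next
    case 2
    then have "(s - tangent_angle s) * cos (\<alpha>/2) < (t - tangent_angle t) * cos (\<alpha>/2)"
      using cos_pos by simp
    moreover have "r * sin (\<alpha>/2 - tangent_angle t) \<le> r * sin (\<alpha>/2 - tangent_angle s)"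
      using r_pos sin_le by simp
    ultimately show ?thesis by (simp add: height)
  qed
qed

lemma inj_param: "inj param"
  by (rule linorder_injI) (metis param_height_strict_antimono less_irrefl)

lemma param_has_vector_derivative:
  assumes "s \<noteq> 0" "s \<noteq> \<alpha>"
  shows "(param has_vector_derivative param_deriv s) (at s)"
proof -
  consider "s < 0" | "0 < s" "s < \<alpha>" | "\<alpha> < s" using assms by linarith
  then show ?thesis
  proof cases
    case 1
    have "((\<lambda>s. (\<epsilon> - s) *\<^sub>R direction_L 0) has_vector_derivative param_deriv s) (at s)"
      using 1 by (auto intro!: derivative_eq_intros simp: param_deriv_def)
    then show ?thesis
      by (rule has_vector_derivative_transform_within_open[of _ _ _ "{..<0}"])
        (use 1 in \<open>auto simp: param_R\<close>)
  next
    case 2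
    have "((\<lambda>s. M + r *\<^sub>R normal_L s) has_vector_derivative param_deriv s) (at s)"
      using 2 by (auto intro!: derivative_eq_intros normal_L_has_vector_derivative
          simp: param_deriv_def)
    then show ?thesis
      by (rule has_vector_derivative_transform_within_open[of _ _ _ "{0<..<\<alpha>}"])
        (use 2 in \<open>auto simp: param_arc\<close>)
  next
    case 3
    have "((\<lambda>s. - ((\<epsilon> + (s - \<alpha>)) *\<^sub>R direction_L \<alpha>)) has_vector_derivative param_deriv s) (at s)"
      using 3 by (auto intro!: derivative_eq_intros simp: param_deriv_def)
    then show ?thesis
      by (rule has_vector_derivative_transform_within_open[of _ _ _ "{\<alpha><..}"])
        (use 3 in \<open>auto simp: param_L\<close>)
  qed
qed

lemma param_piecewise_C1: "param piecewise_C1_differentiable_on S"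
proof -
  have "continuous_on ({..<0} \<union> {0<..<\<alpha>} \<union> {\<alpha><..}) param_deriv"
  proof (intro continuous_on_open_Un)
    show "continuous_on {..<0} param_deriv"
      by (rule continuous_on_eq[of _ "\<lambda>_. - direction_L 0"]) (auto simp: param_deriv_def)
    show "continuous_on {0<..<\<alpha>} param_deriv"
      by (rule continuous_on_eq[of _ "\<lambda>s. - (r *\<^sub>R direction_L s)"])
        (auto simp: param_deriv_def intro!: continuous_intros)
    show "continuous_on {\<alpha><..} param_deriv"
      by (rule continuous_on_eq[of _ "\<lambda>_. - direction_L \<alpha>"]) (use \<alpha> in \<open>auto simp: param_deriv_def\<close>)
  qed auto
  then have "continuous_on (S - {0, \<alpha>}) param_deriv"
    by (rule continuous_on_subset) auto
  then have "param C1_differentiable_on (S - {0, \<alpha>})"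
    unfolding C1_differentiable_on_def using param_has_vector_derivative by blast
  then show ?thesis
    unfolding piecewise_C1_differentiable_on_def
    by (intro conjI continuous_on_param exI[of _ "{0, \<alpha>}"]) auto
qed

section \<open>The pieces of the curve as images of parameter intervals\<close>

lemma piece_R_eq: "piece_R lR \<epsilon> = param ` {A..0}"
proof -
  have "piece_R lR \<epsilon> = (\<lambda>u. u *\<^sub>R direction_L 0) ` {\<epsilon>..lR}"
    using \<epsilon> by (auto simp: piece_R_def segment_R_def direction_R_eq)
  also have "{\<epsilon>..lR} = (\<lambda>s. \<epsilon> - s) ` {A..0}"
    by (simp add: image_diff_atLeastAtMost)
  also have "(\<lambda>u. u *\<^sub>R direction_L 0) ` (\<lambda>s. \<epsilon> - s) ` {A..0} = param ` {A..0}"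
    unfolding image_image by (rule image_cong) (auto simp: param_R)
  finally show ?thesis .
qed

lemma piece_L_eq: "piece_L \<alpha> lL \<epsilon> = param ` {\<alpha>..B}"
proof -
  have "piece_L \<alpha> lL \<epsilon> = (\<lambda>u. - (u *\<^sub>R direction_L \<alpha>)) ` {\<epsilon>..lL}"
    using \<epsilon> by (auto simp: piece_L_def segment_L_def)
  also have "{\<epsilon>..lL} = (\<lambda>s. (\<epsilon> - \<alpha>) + s) ` {\<alpha>..B}"
    using image_add_atLeastAtMost[of "\<epsilon> - \<alpha>" \<alpha> B] by simp
  also have "(\<lambda>u. - (u *\<^sub>R direction_L \<alpha>)) ` (\<lambda>s. (\<epsilon> - \<alpha>) + s) ` {\<alpha>..B} = param ` {\<alpha>..B}"
    unfolding image_image by (rule image_cong) (auto simp: param_L algebra_simps)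
  finally show ?thesis .
qed

lemma piece_arc_eq: "piece_arc \<alpha> \<epsilon> = param ` {0<..<\<alpha>}"
proof -
  have polar: "vector [cos (pi/2 + s), sin (pi/2 + s)] = normal_L s" for s
    by (simp add: vec2_eq_iff cos_add sin_add)
  have "piece_arc \<alpha> \<epsilon> = (\<lambda>s. M + r *\<^sub>R vector [cos s, sin s]) ` {pi/2<..<pi/2 + \<alpha>}"
    by (auto simp: piece_arc_def)
  also have "{pi/2<..<pi/2 + \<alpha>} = (\<lambda>s. pi/2 + s) ` {0<..<\<alpha>}"
    by (auto intro!: image_eqI[where x = "x - pi/2" for x])
  also have "(\<lambda>s. M + r *\<^sub>R vector [cos s, sin s]) ` (\<lambda>s. pi/2 + s) ` {0<..<\<alpha>} = param ` {0<..<\<alpha>}"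
    unfolding image_image by (rule image_cong) (auto simp: param_arc polar)
  finally show ?thesis .
qed

lemma curve_eps_eq: "curve_eps \<alpha> lL lR \<epsilon> = param ` {A..B}"
proof -
  have "{A..B} = {\<alpha>..B} \<union> {0<..<\<alpha>} \<union> {A..0}"
    using \<alpha> \<epsilon> by auto
  then show ?thesis
    by (simp only: curve_eps_def piece_R_eq piece_L_eq piece_arc_eq image_Un)
qed

section \<open>Normal field and tangential Jacobian along the parametrisation\<close>

lemma param_mem_piece_L: "s \<in> {A..B} \<Longrightarrow> param s \<in> piece_L \<alpha> lL \<epsilon> \<longleftrightarrow> \<alpha> \<le> s"
  by (auto simp: piece_L_eq inj_image_mem_iff[OF inj_param])

lemma param_mem_piece_R: "s \<in> {A..B} \<Longrightarrow> param s \<in> piece_R lR \<epsilon> \<longleftrightarrow> s \<le> 0"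
  by (auto simp: piece_R_eq inj_image_mem_iff[OF inj_param])

text \<open>Injectivity of \<open>param\<close> keeps the three pieces disjoint, so the parameter
  alone decides the case in \<open>normal_eps\<close>; on the arc the norm divided by is
  \<open>r\<close>.\<close>

lemma normal_eps_param:
  assumes s: "s \<in> {A..B}"
  shows "normal_eps \<alpha> lL lR \<epsilon> (param s) = normal_L (tangent_angle s)"
proof -
  consider "s \<le> 0" | "0 < s" "s < \<alpha>" | "\<alpha> \<le> s" by linarith
  then show ?thesis
  proof cases
    case 2
    then show ?thesis
      using r_pos by (simp add: normal_eps_def param_mem_piece_L[OF s] param_mem_piece_R[OF s])
        (simp add: param_arc)
  qed (use \<alpha> in \<open>simp_all add: normal_eps_def param_mem_piece_L[OF s] param_mem_piece_R[OF s]
      normal_R_eq\<close>)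
qed

text \<open>The normal is constant on a segment, hence so is an extension. End points and contact
  points are left out because differentiating along the curve needs the piece on both sides;
  finitely many points do not affect the integral.\<close>

lemma jacobian_normal_eps_segment:
  assumes "s \<in> {A<..<0} \<union> {\<alpha><..<B}"
  shows "jacobian_normal_eps \<alpha> lL lR \<epsilon> (param s) = 0"
proof -
  define J where "J = (if s < 0 then {A<..<0} else {\<alpha><..<B})"
  define S where "S = (if s < 0 then piece_R lR \<epsilon> else piece_L \<alpha> lL \<epsilon>)"
  have J: "open J" "s \<in> J" "J \<subseteq> {A..B}"
    using assms \<alpha> \<epsilon> by (auto simp: J_def)
  have S: "S = param ` (if s < 0 then {A..0} else {\<alpha>..B})"
    by (simp add: S_def piece_R_eq piece_L_eq)
  have sAB: "s \<in> {A..B}" using J by blast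
  have normal_S: "normal_eps \<alpha> lL lR \<epsilon> y = normal_L (tangent_angle s)" if yS: "y \<in> S" for y
  proof -
    obtain t where t: "t \<in> (if s < 0 then {A..0} else {\<alpha>..B})" "y = param t"
      using yS unfolding S by (rule imageE)
    then show ?thesis
      using assms \<alpha> \<epsilon> by (auto simp: normal_eps_param split: if_splits)
  qed
  have ev: "\<forall>\<^sub>F t in nhds s. param t \<in> S"
    using eventually_nhds_in_open[OF J(1,2)]
    by eventually_elim (auto simp: J_def S split: if_splits)
  have "tangential_jacobian S (normal_eps \<alpha> lL lR \<epsilon>) (param s)
      = outer_prod 0 (direction_L (tangent_angle s))"
  proof (rule tangential_jacobian_along_curve[where c = param and s = s and k = "-1" and N = "\<lambda>_. normal_L (tangent_angle s)"])
    show "(param has_vector_derivative - 1 *\<^sub>R direction_L (tangent_angle s)) (at s)"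
      using param_has_vector_derivative[of s] assms \<alpha> by (auto simp: param_deriv_def)
    have "\<forall>\<^sub>F t in nhds s. normal_eps \<alpha> lL lR \<epsilon> (param t) = normal_L (tangent_angle s)"
      using ev by eventually_elim (rule normal_S)
    then show "((\<lambda>t. normal_eps \<alpha> lL lR \<epsilon> (param t)) has_vector_derivative - 1 *\<^sub>R 0) (at s)"
      by (subst has_vector_derivative_cong_ev[where g = "\<lambda>_. normal_L (tangent_angle s)"])
        (auto simp: eventually_mono dest: eventually_nhds_x_imp_x)
    show "mat 1 - outer_prod (normal_eps \<alpha> lL lR \<epsilon> (param s)) (normal_eps \<alpha> lL lR \<epsilon> (param s))
        = outer_prod (direction_L (tangent_angle s)) (direction_L (tangent_angle s))"
      by (simp add: normal_eps_param[OF sAB] projection_normal_L)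
  qed (use ev normal_S in auto)
  moreover have "outer_prod 0 (direction_L (tangent_angle s)) = 0"
    by (simp add: outer_prod_def vec_eq_iff)
  moreover have "jacobian_normal_eps \<alpha> lL lR \<epsilon> (param s)
      = tangential_jacobian S (normal_eps \<alpha> lL lR \<epsilon>) (param s)"
    using assms \<alpha>
    by (auto simp: jacobian_normal_eps_def S_def param_mem_piece_L[OF sAB] param_mem_piece_R[OF sAB])
  ultimately show ?thesis by simp
qed

text \<open>The normal turns at unit rate in \<open>s\<close> while the point moves at speed
  \<open>r\<close>, which yields the curvature \<open>1 / r\<close>.\<close>

lemma jacobian_normal_eps_arc:
  assumes s: "0 < s" "s < \<alpha>"
  shows "jacobian_normal_eps \<alpha> lL lR \<epsilon> (param s)
    = (1 / r) *\<^sub>R outer_prod (direction_L s) (direction_L s)"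
proof -
  have AB: "t \<in> {A..B}" if "t \<in> {0<..<\<alpha>}" for t using that \<epsilon> by auto
  have sAB: "s \<in> {A..B}" using AB s by simp
  have ev: "\<forall>\<^sub>F t in nhds s. t \<in> {0<..<\<alpha>}"
    using s by (intro eventually_nhds_in_open) auto
  have "tangential_jacobian (piece_arc \<alpha> \<epsilon>) (normal_eps \<alpha> lL lR \<epsilon>) (param s)
      = outer_prod ((1 / r) *\<^sub>R direction_L s) (direction_L s)"
  \<comment> \<open>The affine field \<open>N\<close> equals the unit normal on the arc, where
    \<open>norm (y - M) = r\<close>, and unlike the normalised field it is smooth at
    \<open>M\<close> too. The sign of \<open>k\<close> reflects motion against
    \<open>direction_L\<close>.\<close>
  proof (rule tangential_jacobian_along_curve[where c = param and s = s and k = "-r" and N = "\<lambda>y. (1 / r) *\<^sub>R (y - M)"])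
    show "(param has_vector_derivative - r *\<^sub>R direction_L s) (at s)"
      using param_has_vector_derivative[of s] s by (auto simp: param_deriv_def)
    have ev': "\<forall>\<^sub>F t in nhds s. normal_eps \<alpha> lL lR \<epsilon> (param t) = normal_L t"
      using ev by eventually_elim (use AB in \<open>auto simp: normal_eps_param\<close>)
    show "((\<lambda>t. normal_eps \<alpha> lL lR \<epsilon> (param t))
        has_vector_derivative - r *\<^sub>R ((1 / r) *\<^sub>R direction_L s)) (at s)"
      using ev' r_pos normal_L_has_vector_derivative[of s]
      by (subst has_vector_derivative_cong_ev[where g = normal_L])
        (auto simp: eventually_mono dest: eventually_nhds_x_imp_x)
    show "mat 1 - outer_prod (normal_eps \<alpha> lL lR \<epsilon> (param s)) (normal_eps \<alpha> lL lR \<epsilon> (param s))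
        = outer_prod (direction_L s) (direction_L s)"
      using s by (simp add: normal_eps_param[OF sAB] projection_normal_L)
    show "\<forall>\<^sub>F t in nhds s. param t \<in> piece_arc \<alpha> \<epsilon>"
      using ev by eventually_elim (simp add: piece_arc_eq)
    show "(1 / r) *\<^sub>R (y - M) = normal_eps \<alpha> lL lR \<epsilon> y" if "y \<in> piece_arc \<alpha> \<epsilon>" for y
    proof -
      obtain t where t: "t \<in> {0<..<\<alpha>}" "y = param t"
        using \<open>y \<in> piece_arc \<alpha> \<epsilon>\<close> by (auto simp: piece_arc_eq)
      then have "normal_eps \<alpha> lL lR \<epsilon> y = normal_L t"
        using AB[of t] by (simp add: normal_eps_param)
      then show ?thesis
        using t r_pos by (simp add: param_arc)
    qed
    show "(\<lambda>y. (1 / r) *\<^sub>R (y - M)) differentiable_on UNIV"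
      by (intro derivative_intros)
  qed (use r_pos in auto)
  then show ?thesis
    using s by (simp add: jacobian_normal_eps_def param_mem_piece_L[OF sAB]
        param_mem_piece_R[OF sAB] outer_prod_scaleR_left)
qed

section \<open>The inverse of the transport map\<close>

text \<open>On \<open>curve_h\<close> the larger of \<open>x \<bullet> \<nu>\<^sub>L\<close> and \<open>x \<bullet> \<nu>\<^sub>R\<close> is \<open>0\<close>, and both equal \<open>- r\<close> at the centre; this
  fixes the distance at which the ray in direction \<open>normal_L s\<close> meets \<open>curve_h\<close>.\<close>

definition preimage :: "real \<Rightarrow> real^2" where
  "preimage s = M + (r / max (cos s) (cos (\<alpha> - s))) *\<^sub>R normal_L s"

text \<open>One of \<open>s\<close> and \<open>\<alpha> - s\<close> is at most
  \<open>\<alpha>/2\<close>, hence less than a right angle.\<close>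

lemma max_cos_pos:
  assumes "0 \<le> s" "s \<le> \<alpha>"
  shows "0 < max (cos s) (cos (\<alpha> - s))"
proof (cases "s \<le> \<alpha> / 2")
  case True
  then have "0 < cos s" using assms \<alpha> by (intro cos_gt_zero_pi) auto
  then show ?thesis by simp
next
  case False
  then have "0 < cos (\<alpha> - s)" using assms \<alpha> by (intro cos_gt_zero_pi) auto
  then show ?thesis by simp
qed

lemma inner_centre:
  "M \<bullet> normal_L 0 = - r" "M \<bullet> direction_L 0 = \<epsilon>"
  "M \<bullet> normal_L \<alpha> = - r" "M \<bullet> direction_L \<alpha> = - \<epsilon>"
proof -
  show "M \<bullet> normal_L 0 = - r" "M \<bullet> direction_L 0 = \<epsilon>"
    unfolding centre_R by (simp_all add: inner_diff_left inner_normal_L inner_direction_L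
        inner_normal_L_direction_L inner_direction_L_normal_L)
  show "M \<bullet> normal_L \<alpha> = - r" "M \<bullet> direction_L \<alpha> = - \<epsilon>"
    unfolding centre_L by (simp_all add: inner_diff_left inner_normal_L inner_direction_L
        inner_normal_L_direction_L inner_direction_L_normal_L)
qed

lemma inner_ray:
  "(M + \<rho> *\<^sub>R normal_L s) \<bullet> normal_L 0 = \<rho> * cos s - r"
  "(M + \<rho> *\<^sub>R normal_L s) \<bullet> normal_L \<alpha> = \<rho> * cos (\<alpha> - s) - r"
  "(M + \<rho> *\<^sub>R normal_L s) \<bullet> direction_L 0 = \<epsilon> - \<rho> * sin s"
  "(M + \<rho> *\<^sub>R normal_L s) \<bullet> direction_L \<alpha> = \<rho> * sin (\<alpha> - s) - \<epsilon>"
  using cos_minus[of "\<alpha> - s"]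
  by (simp_all add: inner_centre inner_add_left inner_normal_L inner_normal_L_direction_L)

text \<open>The segments bound a convex wedge: each lies on its own line and on the nonpositive side
  of the other.\<close>

lemma curve_h_max_normal:
  assumes "x \<in> curve_h \<alpha> lL lR"
  shows "max (x \<bullet> normal_L 0) (x \<bullet> normal_L \<alpha>) = 0"
  using assms sin_\<alpha>_pos
  by (auto simp: curve_h_def segment_L_def segment_R_def direction_R_eq
      inner_direction_L_normal_L max_def mult_le_0_iff)

lemma preimage_mem:
  assumes s: "0 < s" "s < \<alpha>"
  shows "preimage s \<in> curve_h \<alpha> lL lR" and "norm (preimage s) < \<epsilon>"
proof -
  define \<rho> where "\<rho> = r / max (cos s) (cos (\<alpha> - s))"
  have max: "0 < max (cos s) (cos (\<alpha> - s))" using s by (intro max_cos_pos) auto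
  then have \<rho>: "0 < \<rho>" "\<rho> * max (cos s) (cos (\<alpha> - s)) = r"
    using r_pos by (auto simp: \<rho>_def)
  have sin_pos: "0 < sin s" "0 < sin (\<alpha> - s)"
    using s \<alpha> by (auto intro: sin_gt_zero)
  define z where "z = preimage s"
  have z: "z = M + \<rho> *\<^sub>R normal_L s" by (simp add: z_def preimage_def \<rho>_def)
  have "z \<in> curve_h \<alpha> lL lR \<and> norm z < \<epsilon>"
  \<comment> \<open>The larger cosine tells which of the two lines the ray from the centre meets
    first; \<open>v\<close> is the signed distance of that point from the corner.\<close>
  proof (cases "cos (\<alpha> - s) \<le> cos s")
    case True
    define v where "v = \<epsilon> - \<rho> * sin s"
    have \<rho>_cos: "\<rho> * cos s = r" using \<rho> True by (simp add: max_def)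
    then have zv: "z = v *\<^sub>R direction_L 0"
      using orthonormal_expansion[of z 0] by (simp add: z inner_ray v_def)
    have "\<rho> * cos (\<alpha> - s) \<le> r" using \<rho> True \<rho>_cos by (metis less_imp_le mult_left_mono)
    \<comment> \<open>Being on the inner side of the other line excludes the prolongation of the
      segment beyond the corner.\<close>
    then have "z \<bullet> normal_L \<alpha> \<le> 0" by (simp add: z inner_ray)
    then have "0 \<le> v * sin \<alpha>"
      by (simp add: zv inner_direction_L_normal_L)
    then have "0 \<le> v" using sin_\<alpha>_pos by (simp add: zero_le_mult_iff)
    moreover have "v < \<epsilon>" using \<rho> sin_pos by (simp add: v_def)
    ultimately show ?thesis
      using zv \<epsilon> by (auto simp: curve_h_def segment_R_def direction_R_eq)
  next
    case False
    define v where "v = \<epsilon> - \<rho> * sin (\<alpha> - s)"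
    have \<rho>_cos: "\<rho> * cos (\<alpha> - s) = r" using \<rho> False by (simp add: max_def)
    then have "z \<bullet> direction_L \<alpha> = - v" "z \<bullet> normal_L \<alpha> = 0"
      by (simp_all add: z inner_ray v_def)
    then have zv: "z = - (v *\<^sub>R direction_L \<alpha>)"
      using orthonormal_expansion[of z \<alpha>] by simp
    have "\<rho> * cos s \<le> r" using \<rho> False \<rho>_cos by (metis less_imp_le mult_left_mono linear)
    then have "z \<bullet> normal_L 0 \<le> 0" by (simp add: z inner_ray)
    then have "0 \<le> v * sin \<alpha>"
      by (simp add: zv inner_direction_L_normal_L)
    then have "0 \<le> v" using sin_\<alpha>_pos by (simp add: zero_le_mult_iff)
    moreover have "v < \<epsilon>" using \<rho> sin_pos by (simp add: v_def)
    ultimately show ?thesis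
      using zv \<epsilon> by (auto simp: curve_h_def segment_L_def)
  qed
  then show "preimage s \<in> curve_h \<alpha> lL lR" "norm (preimage s) < \<epsilon>"
    by (simp_all add: z_def)
qed

text \<open>Every point of \<open>curve_h\<close> mapped to \<open>param s\<close> lies on the ray
  from the centre through \<open>param s\<close>, and \<open>curve_h_max_normal\<close> fixes its
  distance from the centre. This gives uniqueness, while \<open>preimage_mem\<close> gives
  existence.\<close>

lemma transport_map_inverse:
  assumes s: "0 < s" "s < \<alpha>"
  shows "inv_into (curve_h \<alpha> lL lR) (transport_map \<alpha> \<epsilon>) (param s) = preimage s"
proof -
  have max: "0 < max (cos s) (cos (\<alpha> - s))" using s by (intro max_cos_pos) auto
  have "transport_map \<alpha> \<epsilon> (preimage s) = param s"
    using preimage_mem[OF s] max r_pos s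
    by (simp add: transport_map_def param_arc) (simp add: preimage_def)
  then have "param s \<in> transport_map \<alpha> \<epsilon> ` curve_h \<alpha> lL lR"
    using preimage_mem[OF s] by (metis imageI)
  moreover have "x = preimage s"
    if x: "x \<in> curve_h \<alpha> lL lR" "transport_map \<alpha> \<epsilon> x = param s" for x
  proof -
    have "\<exists>\<rho>\<ge>0. x = M + \<rho> *\<^sub>R normal_L s"
    proof (cases "x \<in> ball 0 \<epsilon>")
      case True
      then have eq: "(r / norm (x - M)) *\<^sub>R (x - M) = r *\<^sub>R normal_L s"
        using x s by (simp add: transport_map_def param_arc)
      \<comment> \<open>At \<open>x = M\<close> the left side of \<open>eq\<close> would be 0,
        whereas the right side has norm \<open>r\<close>.\<close>
      have "x \<noteq> M"
        using eq r_pos by auto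
      then have "x - M = norm (x - M) *\<^sub>R normal_L s"
        using arg_cong[OF eq, of "\<lambda>y. (norm (x - M) / r) *\<^sub>R y"] r_pos by simp
      then show ?thesis by (metis add.commute diff_add_cancel norm_ge_zero)
    next
      case False
      then show ?thesis
        using x s r_pos by (auto simp: transport_map_def param_arc intro!: exI[of _ r])
    qed
    then obtain \<rho> where \<rho>: "0 \<le> \<rho>" "x = M + \<rho> *\<^sub>R normal_L s" by blast
    have "max (\<rho> * cos s - r) (\<rho> * cos (\<alpha> - s) - r) = 0"
      using curve_h_max_normal[OF x(1)] by (simp add: \<rho>(2) inner_ray)
    \<comment> \<open>The sign of \<open>\<rho>\<close> matters here: a nonnegative factor can be
      pulled out of the maximum.\<close>
    then have "\<rho> * max (cos s) (cos (\<alpha> - s)) = r"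
      using \<rho>(1) by (simp add: max_mult_distrib_left max_diff_distrib_left[symmetric])
    then have "\<rho> = r / max (cos s) (cos (\<alpha> - s))"
      using max by (simp add: field_simps)
    then show ?thesis by (simp add: \<rho>(2) preimage_def)
  qed
  ultimately show ?thesis
    by (metis f_inv_into_f inv_into_into)
qed

lemma continuous_on_preimage: "continuous_on {0..\<alpha>} preimage"
  unfolding preimage_def using max_cos_pos
  by (intro continuous_intros) (auto simp: order.strict_iff_order)

text \<open>At \<open>s = 0\<close> and \<open>s = \<alpha>\<close> the preimage is a contact point,
  with norm exactly \<open>\<epsilon>\<close>; the weak bound there follows from the open interval
  by continuity.\<close>

lemma norm_preimage_le:
  assumes "s \<in> {0..\<alpha>}"
  shows "norm (preimage s) \<le> \<epsilon>"
proof (rule continuous_le_on_closure[where S = "{0<..<\<alpha>}" and f = "\<lambda>s. norm (preimage s)"])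
  show "continuous_on (closure {0<..<\<alpha>}) (\<lambda>s. norm (preimage s))"
    using \<alpha> continuous_on_preimage by (auto intro: continuous_on_norm)
qed (use assms \<alpha> preimage_mem in \<open>auto intro: less_imp_le\<close>)

section \<open>Evaluation of the curve integral\<close>

lemma curve_integral_smoothed:
  fixes \<Psi> :: "real^2 \<Rightarrow> real"
  assumes \<Psi>: "continuous_on UNIV \<Psi>" and \<mu>: "tangent_field \<alpha> lL lR \<epsilon> \<mu>"
  shows "curve_integral (curve_eps \<alpha> lL lR \<epsilon>)
      (\<lambda>x. - frobenius_inner (jacobian_normal_eps \<alpha> lL lR \<epsilon> x)
                (transported_test \<alpha> lL lR \<epsilon> \<mu> \<Psi> x))
    = - integral {0..\<alpha>} (\<lambda>s. \<Psi> (preimage s))"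
proof -
  define f where "f x = - frobenius_inner (jacobian_normal_eps \<alpha> lL lR \<epsilon> x)
                (transported_test \<alpha> lL lR \<epsilon> \<mu> \<Psi> x)" for x
  define k where "k s = \<Psi> (preimage s)" for s
  \<comment> \<open>Because the angle is clamped, this primitive is constant on the segments, where
    the integrand vanishes, and accumulates only along the arc.\<close>
  define F where "F s = - integral {0..tangent_angle s} k" for s
  have contk: "continuous_on {0..\<alpha>} k"
    unfolding k_def by (rule continuous_on_compose2[OF \<Psi> continuous_on_preimage]) simp
  have f_arc: "f (param s) = - k s / r" if s: "0 < s" "s < \<alpha>" for s
  proof -
    have "param s \<in> piece_arc \<alpha> \<epsilon>" using s by (simp add: piece_arc_eq)
    then have "\<mu> (param s) = (1 / r) *\<^sub>R
        vector [- (param s $ 2 - M $ 2), param s $ 1 - M $ 1]"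
      using \<mu> by (simp add: tangent_field_def)
    \<comment> \<open>The sign cancels in \<open>\<mu> \<otimes> \<mu>\<close>.\<close>
    also have "\<dots> = - direction_L s"
      using s r_pos by (simp add: param_arc vec2_eq_iff)
    finally show ?thesis
      using s by (simp add: f_def jacobian_normal_eps_arc transported_test_def transport_map_inverse
          frobenius_inner_scaleR_left frobenius_inner_scaleR_right outer_prod_minus_minus
          frobenius_inner_outer_prod inner_direction_L k_def)
  qed
  have f_segment: "f (param s) = 0" if "s \<in> {A<..<0} \<union> {\<alpha><..<B}" for s
    using jacobian_normal_eps_segment[OF that] by (simp add: f_def frobenius_inner_def)
  have "has_curve_integral f (F B - F A) (param ` {A..B})"
  proof (rule has_curve_integral_parametrised[where K = "{0, \<alpha>}" and \<gamma>' = param_deriv])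
    show "inj_on param {A..B}" using inj_param by (rule inj_on_subset) simp
    have "continuous_on {0..\<alpha>} (\<lambda>s. - integral {0..s} k)"
      by (intro continuous_intros indefinite_integral_continuous_1 integrable_continuous_real contk)
    then show "continuous_on {A..B} F"
      unfolding F_def by (rule continuous_on_compose2[OF _ continuous_on_tangent_angle])
        (use \<alpha> in \<open>auto simp: tangent_angle_def\<close>)
    fix s assume s: "s \<in> {A<..<B} - {0, \<alpha>}"
    then show "(param has_vector_derivative param_deriv s) (at s)"
      by (intro param_has_vector_derivative) auto
    have "norm (param_deriv s) > 0"
      using r_pos by (simp add: param_deriv_def)
    then show "param_deriv s \<noteq> 0" by auto
    consider "s < 0" | "0 < s" "s < \<alpha>" | "\<alpha> < s" using s by force
    then show "(F has_real_derivative f (param s) * norm (param_deriv s)) (at s)"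
    proof cases
      case 1
      have "((\<lambda>_. F 0) has_real_derivative f (param s) * norm (param_deriv s)) (at s)"
        using f_segment[of s] s 1 by simp
      then show ?thesis
        by (rule has_field_derivative_transform_within_open[where S = "{..<0}"])
          (use 1 in \<open>auto simp: F_def\<close>)
    next
      case 2
      have "((\<lambda>s. integral {0..s} k) has_real_derivative k s) (at s within {0..\<alpha>})"
        using 2 by (intro integral_has_real_derivative contk) auto
      then have "((\<lambda>s. - integral {0..s} k) has_real_derivative - k s) (at s)"
        using 2 by (intro DERIV_minus) (simp add: at_within_Icc_at)
      moreover have "f (param s) * norm (param_deriv s) = - k s"
        using 2 f_arc[of s] r_pos by (simp add: param_deriv_def)
      ultimately have
        "((\<lambda>s. - integral {0..s} k) has_real_derivative f (param s) * norm (param_deriv s)) (at s)"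
        by simp
      then show ?thesis
        by (rule has_field_derivative_transform_within_open[where S = "{0<..<\<alpha>}"])
          (use 2 in \<open>auto simp: F_def\<close>)
    next
      case 3
      have "((\<lambda>_. F \<alpha>) has_real_derivative f (param s) * norm (param_deriv s)) (at s)"
        using f_segment[of s] s 3 by simp
      then show ?thesis
        by (rule has_field_derivative_transform_within_open[where S = "{\<alpha><..}"])
          (use 3 \<alpha> in \<open>auto simp: F_def\<close>)
    qed
  qed (use \<alpha> \<epsilon> param_piecewise_C1 in auto)
  then have "curve_integral (curve_eps \<alpha> lL lR \<epsilon>) f = F B - F A"
    by (simp add: curve_eps_eq curve_integral_eqI)
  then show ?thesis
    using \<alpha> \<epsilon> by (simp add: f_def[abs_def] k_def[abs_def] F_def)
qed

end

section \<open>Passage to the limit at the corner\<close>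

theorem mainTheorem2:
  fixes \<alpha> lL lR :: real
    and \<Psi> :: "real^2 \<Rightarrow> real"
    and \<mu> :: "real \<Rightarrow> real^2 \<Rightarrow> real^2"
  assumes "0 < \<alpha>" and "\<alpha> < pi"
    and "0 < lL" and "0 < lR"
    and "continuous_on UNIV \<Psi>"
    and "\<And>\<epsilon>. 0 < \<epsilon> \<Longrightarrow> \<epsilon> < min lL lR \<Longrightarrow> tangent_field \<alpha> lL lR \<epsilon> (\<mu> \<epsilon>)"
  shows "((\<lambda>\<epsilon>. curve_integral (curve_eps \<alpha> lL lR \<epsilon>)
             (\<lambda>x. - frobenius_inner (jacobian_normal_eps \<alpha> lL lR \<epsilon> x)
                      (transported_test \<alpha> lL lR \<epsilon> (\<mu> \<epsilon>) \<Psi> x)))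
          \<longlongrightarrow> - normal_angle (normal_L \<alpha>) normal_R * \<Psi> 0) (at_right 0)"
proof (rule tendstoI)
  fix e :: real assume "0 < e"
  \<comment> \<open>A deviation of at most \<open>d\<close> over an interval of length
    \<open>\<alpha>\<close> integrates to at most \<open>e / 2\<close>.\<close>
  define d where "d = e / (2 * \<alpha>)"
  have "0 < d" using \<open>0 < e\<close> \<open>0 < \<alpha>\<close> by (simp add: d_def)
  then obtain \<delta> where "0 < \<delta>" and \<delta>: "\<And>x. norm x < \<delta> \<Longrightarrow> \<bar>\<Psi> x - \<Psi> 0\<bar> < d"
    using assms(5) unfolding continuous_on_iff by (force simp: dist_norm)
  have angle: "normal_angle (normal_L \<alpha>) normal_R = \<alpha>"
    using assms(1,2) by (simp add: normal_angle_def normal_R_eq inner_normal_L arccos_cos)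
  \<comment> \<open>Below \<open>\<delta>\<close> all preimages lie where \<open>\<Psi>\<close> is
    close to \<open>\<Psi> 0\<close>; below both lengths the locale \<open>smoothed_corner\<close>
    applies.\<close>
  have "\<forall>\<^sub>F \<epsilon> in at_right 0. \<epsilon> \<in> {0<..<min \<delta> (min lL lR)}"
    using \<open>0 < \<delta>\<close> assms(3,4) by (intro eventually_at_right_real) auto
  then show "\<forall>\<^sub>F \<epsilon> in at_right 0. dist (curve_integral (curve_eps \<alpha> lL lR \<epsilon>)
             (\<lambda>x. - frobenius_inner (jacobian_normal_eps \<alpha> lL lR \<epsilon> x)
                      (transported_test \<alpha> lL lR \<epsilon> (\<mu> \<epsilon>) \<Psi> x)))
          (- normal_angle (normal_L \<alpha>) normal_R * \<Psi> 0) < e"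
  proof eventually_elim
    case (elim \<epsilon>)
    then interpret smoothed_corner \<alpha> lL lR \<epsilon>
      using assms(1,2) by unfold_locales auto
    have cont: "continuous_on {0..\<alpha>} (\<lambda>s. \<Psi> (preimage s))"
      by (rule continuous_on_compose2[OF assms(5) continuous_on_preimage]) simp
    have "norm (integral {0..\<alpha>} (\<lambda>s. \<Psi> (preimage s) - \<Psi> 0)) \<le> d * (\<alpha> - 0)"
    proof (rule integral_bound)
      fix s assume "s \<in> {0..\<alpha>}"
      then have "norm (preimage s) < \<delta>" using norm_preimage_le[of s] elim by simp
      then show "norm (\<Psi> (preimage s) - \<Psi> 0) \<le> d" using \<delta> by (simp add: less_imp_le)
    qed (use \<alpha> cont in \<open>auto intro!: continuous_on_diff\<close>)
    moreover have "integral {0..\<alpha>} (\<lambda>s. \<Psi> (preimage s) - \<Psi> 0)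
        = integral {0..\<alpha>} (\<lambda>s. \<Psi> (preimage s)) - \<alpha> * \<Psi> 0"
      using \<alpha> cont by (subst integral_diff) (auto intro: integrable_continuous_real)
    moreover have "d * \<alpha> < e" using \<open>0 < e\<close> \<alpha> by (simp add: d_def)
    ultimately show ?case
      using elim by (simp add: curve_integral_smoothed assms(5,6) angle dist_real_def abs_minus_commute)
  qed
qed

end
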